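(* With respect to the symmetric measure on triangles of perimeter 2, the probability that a random triangle is obtuse is exactly $$\frac{3}{2}-\frac{3\ln 2}{\pi}.$$ Equivalently, the set of points $(x,y,z)\in S^2$ for which the triangle with sidelengths $a=1-x^2$, $b=1-y^2$, $c=1-z^2$ is obtuse has area $6\pi-12\ln 2$ in the unit sphere $S^2$ (whose total area is $4\pi$).
   Context: A triangle of perimeter 2 is recorded by its sidelengths $(a,b,c)$ with $a+b+c=2$ satisfying the (non-strict) triangle inequalities. The symmetric measure on the space of perimeter-2 triangles is the pushforward of the uniform probability measure on the unit sphere $S^2=\{x^2+y^2+z^2=1\}\subset\mathbb{R}^3$ under the map $(x,y,z)\mapsto(a,b,c)=(1-x^2,1-y^2,1-z^2)$. A triangle is obtuse if one of its angles is greater than $\pi/2$, i.e. if $a^2+b^2<c^2$ or $b^2+c^2<a^2$ or $c^2+a^2<b^2$. *)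

theory Defs
  imports "HOL-Probability.Probability"
begin

text \<open>The unit sphere \<open>S\<^sup>2\<close> is \<^term>\<open>sphere (0 :: real ^ 3) 1\<close>.  Its area measure is given
  by the usual cone construction: the area of \<open>E\<close> is three times the Lebesgue volume of the set of
  all \<open>r x\<close> with \<open>0 < r < 1\<close> and \<open>x \<in> E\<close>, i.e. three times the image of Lebesgue measure on
  the unit ball under radial projection.\<close>

definition sphere_area :: "(real ^ 3) measure" where
  "sphere_area = scale_measure 3
     (distr (restrict_space lborel (ball 0 1 - {0})) (restrict_space borel (sphere 0 1)) sgn)"

definition sphere_uniform :: "(real ^ 3) measure" where
  "sphere_uniform = uniform_measure sphere_area (sphere 0 1)"

definition perimeter2_triangles :: "(real \<times> real \<times> real) set" where
  "perimeter2_triangles =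
     {(a, b, c). a + b + c = 2 \<and> a \<le> b + c \<and> b \<le> c + a \<and> c \<le> a + b}"

definition obtuse :: "real \<times> real \<times> real \<Rightarrow> bool" where
  "obtuse = (\<lambda>(a, b, c). a\<^sup>2 + b\<^sup>2 < c\<^sup>2 \<or> b\<^sup>2 + c\<^sup>2 < a\<^sup>2 \<or> c\<^sup>2 + a\<^sup>2 < b\<^sup>2)"

definition triangle_of :: "real ^ 3 \<Rightarrow> real \<times> real \<times> real" where
  "triangle_of p = (1 - (p $ 1)\<^sup>2, 1 - (p $ 2)\<^sup>2, 1 - (p $ 3)\<^sup>2)"

definition symmetric_measure :: "(real \<times> real \<times> real) measure" where
  "symmetric_measure =
     distr sphere_uniform (restrict_space borel perimeter2_triangles) triangle_of"

lemma space_sphere_area [simp]: "space sphere_area = sphere 0 1"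
  by (simp add: sphere_area_def space_scale_measure space_restrict_space)

lemma sets_sphere_area [simp, measurable_cong]:
  "sets sphere_area = sets (restrict_space borel (sphere 0 1))"
  by (simp add: sphere_area_def)

lemma radial_measurable:
  "(sgn :: real ^ 3 \<Rightarrow> _) \<in> restrict_space lborel (ball 0 1 - {0}) \<rightarrow>\<^sub>M restrict_space borel (sphere 0 1)"
proof (rule measurable_restrict_space2)
  show "sgn \<in> space (restrict_space lborel (ball 0 1 - {0})) \<rightarrow> sphere (0 :: real ^ 3) 1"
    by (auto simp: space_restrict_space norm_sgn)
  have "(sgn :: real ^ 3 \<Rightarrow> _) \<in> borel_measurable borel"
    unfolding sgn_div_norm by measurable
  then show "(sgn :: real ^ 3 \<Rightarrow> _) \<in> borel_measurable (restrict_space lborel (ball 0 1 - {0}))"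
    by (intro measurable_restrict_space1) simp
qed

lemma triangle_of_measurable:
  "triangle_of \<in> restrict_space borel (sphere 0 1) \<rightarrow>\<^sub>M restrict_space borel perimeter2_triangles"
proof (rule measurable_restrict_space2)
  have "(p $ 1)\<^sup>2 + (p $ 2)\<^sup>2 + (p $ 3)\<^sup>2 = 1" if "norm p = 1" for p :: "real ^ 3"
    using that by (simp add: norm_eq_1 inner_vec_def sum_3 power2_eq_square)
  then show "triangle_of \<in> space (restrict_space borel (sphere 0 1)) \<rightarrow> perimeter2_triangles"
    by (auto simp: space_restrict_space triangle_of_def perimeter2_triangles_def)
       (smt (verit) zero_le_power2)+
  have "continuous_on UNIV triangle_of"
    unfolding triangle_of_def by (intro continuous_intros)
  then show "triangle_of \<in> borel_measurable (restrict_space borel (sphere 0 1))"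
    by (intro measurable_restrict_space1 borel_measurable_continuous_onI)
qed

lemma cone_eq:
  fixes E :: "(real ^ 3) set"
  assumes "E \<subseteq> sphere 0 1"
  shows "sgn -` E \<inter> (ball 0 1 - {0}) = {r *\<^sub>R x |r x. 0 < r \<and> r < 1 \<and> x \<in> E}" (is "?A = ?B")
proof
  show "?A \<subseteq> ?B"
  proof
    fix y assume y: "y \<in> ?A"
    then have "y = norm y *\<^sub>R sgn y" by (simp add: sgn_div_norm)
    with y show "y \<in> ?B"
      by (auto intro!: exI[of _ "norm y"] exI[of _ "sgn y"])
  qed
  show "?B \<subseteq> ?A"
  proof
    fix y assume "y \<in> ?B"
    then obtain r x where y: "y = r *\<^sub>R x" "0 < r" "r < 1" "x \<in> E" by blast
    with assms have "norm x = 1" by auto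
    with y show "y \<in> ?A" by (auto simp: sgn_div_norm)
  qed
qed

lemma emeasure_sphere_area:
  assumes "E \<in> sets borel" "E \<subseteq> sphere 0 1"
  shows "emeasure sphere_area E = 3 * emeasure lborel {r *\<^sub>R x |r x. 0 < r \<and> r < 1 \<and> x \<in> E}"
proof -
  note eq = cone_eq[OF assms(2)]
  have E: "E \<in> sets (restrict_space borel (sphere 0 1))"
    using assms by (auto simp: sets_restrict_space_iff)
  show ?thesis
    unfolding sphere_area_def
    using E by (simp add: emeasure_distr[OF radial_measurable] space_restrict_space
        emeasure_restrict_space eq[symmetric])
qed

lemma sphere_area_total: "emeasure sphere_area (sphere 0 1) = ennreal (4 * pi)"
proof -
  have "emeasure sphere_area (sphere 0 1) = 3 * emeasure lborel (ball (0 :: real ^ 3) 1 - {0})"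
  proof -
    have *: "(sgn :: real ^ 3 \<Rightarrow> _) -` sphere 0 1 \<inter> (ball 0 1 - {0}) = ball 0 1 - {0}"
      by (auto simp: norm_sgn)
    have "sphere 0 1 \<in> sets (restrict_space borel (sphere (0 :: real ^ 3) 1))"
      by (auto simp: sets_restrict_space_iff)
    then show ?thesis
      unfolding sphere_area_def
      by (simp add: emeasure_distr[OF radial_measurable] space_restrict_space
          emeasure_restrict_space *)
  qed
  also have "emeasure lborel (ball (0 :: real ^ 3) 1 - {0}) = emeasure lborel (ball (0 :: real ^ 3) 1)"
    by (subst emeasure_Diff) auto
  also have "\<dots> = ennreal (4 / 3 * pi)"
    by (simp add: emeasure_ball unit_ball_vol_3)
  also have "3 * ennreal (4 / 3 * pi) = ennreal (3 * (4 / 3 * pi))"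
    by (subst ennreal_mult) auto
  finally show ?thesis by simp
qed

lemma prob_space_symmetric_measure: "prob_space symmetric_measure"
proof -
  have "prob_space sphere_uniform"
    unfolding sphere_uniform_def
    by (rule prob_space_uniform_measure) (auto simp: sphere_area_total)
  moreover have "triangle_of \<in> sphere_uniform \<rightarrow>\<^sub>M restrict_space borel perimeter2_triangles"
    using triangle_of_measurable by (simp add: sphere_uniform_def cong: measurable_cong_sets)
  ultimately show ?thesis
    unfolding symmetric_measure_def by (rule prob_space.prob_space_distr)
qed

text \<open>Together with its total mass, rotation invariance characterizes \<^const>\<open>sphere_area\<close>.\<close>

lemma sphere_area_orthogonal_invariant:
  assumes f: "orthogonal_transformation f" and E: "E \<in> sets borel" "E \<subseteq> sphere 0 1"
  shows "emeasure sphere_area (f ` E) = emeasure sphere_area E"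
proof -
  define C where "C E = {r *\<^sub>R x |r x. 0 < r \<and> r < 1 \<and> x \<in> E}" for E :: "(real ^ 3) set"
  have eq: "sgn -` E \<inter> (ball 0 1 - {0}) = C E" if "E \<subseteq> sphere 0 1" for E :: "(real ^ 3) set"
    unfolding C_def using that by (rule cone_eq)
  have Cb: "C E \<in> sets borel" if "E \<in> sets borel" "E \<subseteq> sphere 0 1" for E
  proof -
    have "(sgn :: real ^ 3 \<Rightarrow> _) \<in> borel_measurable borel"
      unfolding sgn_div_norm by measurable
    then have "sgn -` E \<in> sets borel"
      using that(1) by (rule measurable_sets_borel)
    then show ?thesis
      using eq[OF that(2)] by (metis sets.Diff sets.Int borel_open open_ball borel_singleton sets.empty_sets)
  qed
  have lin: "linear f" and bij: "bij f"
    using f by (auto simp: orthogonal_transformation_linear orthogonal_transformation_bij)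
  have fb: "f ` E \<in> sets borel"
  proof -
    have g: "orthogonal_transformation (inv f)"
      using f by (rule orthogonal_transformation_inv)
    then have "inv f \<in> borel_measurable borel"
      by (intro borel_measurable_continuous_onI linear_continuous_on linear_conv_bounded_linear[THEN iffD1]
          orthogonal_transformation_linear)
    then have "inv f -` E \<in> sets borel"
      using E(1) by (rule measurable_sets_borel)
    then show ?thesis
      using bij_vimage_eq_inv_image[OF bij_imp_bij_inv[OF bij]] by (simp add: inv_inv_eq bij)
  qed
  have fs: "f ` E \<subseteq> sphere 0 1"
    using E f by (auto simp: orthogonal_transformation_norm)
  have Cf: "C (f ` E) = f ` C E"
  proof -
    have "C A = (\<Union>r\<in>{0<..<1}. (\<lambda>x. r *\<^sub>R x) ` A)" for A
      unfolding C_def by auto blast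
    then show ?thesis
      using lin by (simp add: image_UN image_image linear_scale)
  qed
  have CE: "C E \<in> lmeasurable"
  proof (rule bounded_set_imp_lmeasurable)
    show "bounded (C E)"
      using eq[OF E(2)] by (metis bounded_ball bounded_subset Diff_subset inf.coboundedI2)
    show "C E \<in> sets lebesgue"
      using Cb[OF E] by simp
  qed
  have "emeasure lebesgue (f ` C E) = emeasure lebesgue (C E)"
    using measure_orthogonal_image[OF f CE] measurable_orthogonal_image[OF f CE] CE
    by (simp add: emeasure_eq_measure2)
  moreover have "f ` C E \<in> sets borel"
    using Cb[OF fb fs] by (simp add: Cf)
  ultimately have "emeasure lborel (f ` C E) = emeasure lborel (C E)"
    using Cb[OF E] by (simp add: emeasure_completion main_part_sets)
  then show ?thesis
    using emeasure_sphere_area[OF E] emeasure_sphere_area[OF fb fs] by (simp add: Cf flip: C_def)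
qed

end

theory Submission
  imports Defs "HOL-Real_Asymp.Real_Asymp"
begin

text \<open>
  The argument splits the obtuse points of the sphere according to the position of the obtuse angle
  and computes the area of each piece in a gnomonic chart.

  On the sphere, \<open>a\<^sup>2 + b\<^sup>2 < c\<^sup>2\<close> collapses to \<open>\<bar>z\<bar> < \<bar>x y\<bar>\<close>, because
  \<open>c\<^sup>2 - a\<^sup>2 - b\<^sup>2 = 2 (x\<^sup>2 y\<^sup>2 - z\<^sup>2)\<close> when \<open>x\<^sup>2 + y\<^sup>2 + z\<^sup>2 = 1\<close> (\<open>obtuse_at_iff\<close>).
  A triangle has at most one obtuse angle, so the obtuse set is the disjoint union of this region and
  its two images under cyclic permutation of the coordinates.

  Central projection from the origin to the plane \<open>x = 1\<close>, with coordinates \<open>u = y / x\<close> and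
  \<open>v = z / x\<close>, turns area on the sphere into the density \<open>(1 + u\<^sup>2 + v\<^sup>2) powr (-3/2)\<close>,
  counted twice since antipodal points have the same image (\<open>sphere_area_gnomonic\<close>). The region becomes
  \<open>\<bar>v\<bar> sqrt (1 + u\<^sup>2 + v\<^sup>2) < \<bar>u\<bar>\<close>. For fixed \<open>v\<close> with \<open>\<bar>v\<bar> < 1\<close> this says \<open>\<bar>u\<bar> > U\<close>
  with \<open>U\<^sup>2 = v\<^sup>2 (1 + v\<^sup>2) / (1 - v\<^sup>2)\<close>. An antiderivative of the density in \<open>u\<close> is
  \<open>u / ((1 + v\<^sup>2) sqrt (1 + u\<^sup>2 + v\<^sup>2))\<close>, whose value at \<open>U\<close> is just \<open>\<bar>v\<bar> / (1 + v\<^sup>2)\<close>;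
  all square roots disappear, and the slice contributes \<open>4 (1 - \<bar>v\<bar>) / (1 + v\<^sup>2)\<close>
  (\<open>nn_integral_obtuse_slice\<close>). Integrating over \<open>v\<close> gives
  \<open>8 (pi / 4 - ln 2 / 2) = 2 pi - 4 ln 2\<close> for each position of the obtuse angle, hence
  \<open>6 pi - 12 ln 2\<close> in total, and division by \<open>4 pi\<close> gives the probability.
\<close>

section \<open>Lebesgue integrals\<close>

lemma nn_integral_lborel_even:
  fixes f :: "real \<Rightarrow> ennreal"
  assumes [measurable]: "f \<in> borel_measurable borel" and even: "\<And>x. f (- x) = f x"
  shows "(\<integral>\<^sup>+x. f x \<partial>lborel) = 2 * (\<integral>\<^sup>+x. f x * indicator {0..} x \<partial>lborel)"
proof -
  have "(\<integral>\<^sup>+x. f x \<partial>lborel)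
      = (\<integral>\<^sup>+x. f x * indicator {0..} x + f x * indicator {..0} x \<partial>lborel)"
    by (intro nn_integral_cong_AE eventually_mono[OF AE_lborel_singleton[of 0]])
       (auto simp: indicator_def)
  also have "\<dots> = (\<integral>\<^sup>+x. f x * indicator {0..} x \<partial>lborel) + (\<integral>\<^sup>+x. f x * indicator {..0} x \<partial>lborel)"
    by (rule nn_integral_add) auto
  also have "(\<integral>\<^sup>+x. f x * indicator {..0} x \<partial>lborel) = (\<integral>\<^sup>+x. f x * indicator {0..} x \<partial>lborel)"
    by (subst nn_integral_real_affine[where c = "-1" and t = 0])
       (auto simp: even indicator_def intro!: nn_integral_cong)
  finally show ?thesis by (simp add: mult_2)
qed

text \<open>Named coordinates in an arbitrary order make one computation serve all three positions
  of the obtuse angle.\<close>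

definition from_coords :: "'n \<Rightarrow> 'n \<Rightarrow> real \<times> real \<times> real \<Rightarrow> real ^ 'n" where
  "from_coords i j = (\<lambda>(x, y, z). \<chi> m. if m = i then x else if m = j then y else z)"

lemma continuous_from_coords: "continuous_on UNIV (from_coords i j)"
proof -
  have *: "continuous_on UNIV (\<lambda>w. if m = i then fst w else if m = j then fst (snd w) else snd (snd w))"
    for m :: 'a and i j by (cases "m = i"; cases "m = j") (auto intro!: continuous_intros)
  show ?thesis
    unfolding from_coords_def case_prod_beta by (intro continuous_on_vec_lambda *)
qed

text \<open>This transports Lebesgue measure from an iterated product, where Fubini's theorem applies,
  to a space of vectors. It holds because Lebesgue measure is determined by its values on boxes, and
  coordinate boxes correspond.\<close>

lemma lborel_from_coords:
  fixes i j k :: "'n :: finite"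
  assumes ijk: "distinct [i, j, k]" "UNIV = {i, j, k}"
  shows "distr lborel borel (from_coords i j) = (lborel :: (real ^ 'n) measure)"
proof (rule lborel_eqI[symmetric])
  have [measurable]: "from_coords i j \<in> borel_measurable borel"
    by (intro borel_measurable_continuous_onI continuous_from_coords)
  fix l u :: "real ^ 'n"
  assume lu: "\<And>b. b \<in> Basis \<Longrightarrow> l \<bullet> b \<le> u \<bullet> b"
  have le: "l $ m \<le> u $ m" for m
    using lu[of "axis m 1"] by (simp add: inner_axis axis_in_Basis_iff)
  have "from_coords i j -` box l u
      = {l $ i<..<u $ i} \<times> {l $ j<..<u $ j} \<times> {l $ k<..<u $ k}"
  proof -
    have all: "(\<forall>m. P m) \<longleftrightarrow> P i \<and> P j \<and> P k" for P
      using ijk by (metis UNIV_I insertE singletonD)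
    show ?thesis
      using ijk(1) by (auto simp: mem_box_cart from_coords_def all)
  qed
  then have "emeasure (distr lborel borel (from_coords i j)) (box l u)
      = emeasure lborel ({l $ i<..<u $ i} \<times> {l $ j<..<u $ j} \<times> {l $ k<..<u $ k})"
    by (simp add: emeasure_distr)
  also have "\<dots> = ennreal ((u $ i - l $ i) * ((u $ j - l $ j) * (u $ k - l $ k)))"
    by (simp add: lborel_prod[symmetric] lborel_pair.emeasure_pair_measure_Times
        lborel.emeasure_pair_measure_Times le ennreal_mult)
  also have "(u $ i - l $ i) * ((u $ j - l $ j) * (u $ k - l $ k)) = (\<Prod>m\<in>UNIV. u $ m - l $ m)"
    using ijk by (simp add: ijk(2))
  also have "\<dots> = (\<Prod>b\<in>Basis. (u - l) \<bullet> b)"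
  proof -
    have "Basis = range (\<lambda>m. axis m 1 :: real ^ 'n)"
      by (auto simp: Basis_vec_def)
    moreover have "inj (\<lambda>m :: 'n. axis m (1 :: real))"
      by (simp add: inj_on_def axis_eq_axis)
    ultimately show ?thesis
      by (intro prod.reindex_cong[symmetric]) (auto simp: inner_axis)
  qed
  finally show "emeasure (distr lborel borel (from_coords i j)) (box l u)
      = ennreal (\<Prod>b\<in>Basis. (u - l) \<bullet> b)" .
qed simp

text \<open>The radial integral of a cone of height \<open>1 / s\<close> and its mirror image: slices parallel to the
  base scale with \<open>x\<^sup>2\<close>.\<close>

lemma nn_integral_square_symmetric_interval:
  assumes "s > 0"
  shows "(\<integral>\<^sup>+x. ennreal (x\<^sup>2) * indicator {x. \<bar>x\<bar> * s < 1} x \<partial>lborel) = ennreal (2 / (3 * s ^ 3))"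
proof -
  have bounds: "\<bar>x\<bar> * s < 1 \<longleftrightarrow> - (1 / s) < x \<and> x < 1 / s" for x
    using assms by (simp add: pos_less_divide_eq[symmetric] abs_less_iff) linarith
  have "(\<integral>\<^sup>+x. ennreal (x\<^sup>2) * indicator {x. \<bar>x\<bar> * s < 1} x \<partial>lborel)
      = (\<integral>\<^sup>+x. ennreal (x\<^sup>2) * indicator {-(1/s)..1/s} x \<partial>lborel)"
    using assms
    by (intro nn_integral_cong_AE eventually_mono[OF
            AE_conjI[OF AE_lborel_singleton[of "1/s"] AE_lborel_singleton[of "-(1/s)"]]])
       (auto simp: indicator_def bounds)
  also have "\<dots> = ennreal ((1/s) ^ 3 / 3 - (-(1/s)) ^ 3 / 3)"
    using assms by (intro nn_integral_FTC_Icc) (auto intro!: derivative_eq_intros)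
  also have "(1/s) ^ 3 / 3 - (-(1/s)) ^ 3 / 3 = 2 / (3 * s ^ 3)"
    using assms by (simp add: field_simps)
  finally show ?thesis .
qed

section \<open>Sphere area in a gnomonic chart\<close>

lemma UNIV_3_eq:
  fixes i j k :: 3
  assumes "distinct [i, j, k]"
  shows "UNIV = {i, j, k}"
proof -
  have "card {i, j, k} = card (UNIV :: 3 set)"
    using assms by simp
  then show ?thesis by (metis card_subset_eq finite subset_UNIV)
qed

text \<open>Sphere area is three times the volume of a cone. In the cone over \<open>E\<close>, substituting
  \<open>y = x u\<close> and \<open>z = x v\<close> at each fixed \<open>x\<close> contributes the factor \<open>x\<^sup>2\<close>, and the condition
  of lying in the ball becomes \<open>\<bar>x\<bar> sqrt (1 + u\<^sup>2 + v\<^sup>2) < 1\<close>. Integrating over \<open>x\<close> first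
  leaves the density; both signs of \<open>x\<close> occur, which accounts for the numerator 2.\<close>

lemma sphere_area_gnomonic:
  fixes i j k :: 3 and A :: "(real \<times> real) set"
  assumes ijk: "distinct [i, j, k]" and A[measurable]: "A \<in> sets borel"
  defines "E \<equiv> {p \<in> sphere 0 1. p $ i \<noteq> 0 \<and> (p $ j / p $ i, p $ k / p $ i) \<in> A}"
  shows "E \<in> sets borel"
    and "emeasure sphere_area E
      = (\<integral>\<^sup>+v. \<integral>\<^sup>+u. ennreal (2 / sqrt (1 + u\<^sup>2 + v\<^sup>2) ^ 3) * indicator A (u, v) \<partial>lborel \<partial>lborel)"
proof -
  note UN = UNIV_3_eq[OF ijk]
  have comp[measurable]: "(\<lambda>p :: real ^ 3. p $ m) \<in> borel_measurable borel" for m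
    by (intro borel_measurable_continuous_onI continuous_intros)
  have [measurable]: "from_coords i j \<in> borel_measurable borel"
    by (intro borel_measurable_continuous_onI continuous_from_coords)
  show E: "E \<in> sets borel"
    unfolding E_def by measurable
  define C where "C = {p \<in> ball 0 1. p $ i \<noteq> 0 \<and> (p $ j / p $ i, p $ k / p $ i) \<in> A}"
  have C[measurable]: "C \<in> sets borel"
    unfolding C_def by measurable
  have sub: "E \<subseteq> sphere 0 1" by (auto simp: E_def)
  have cone: "{r *\<^sub>R x |r x. 0 < r \<and> r < 1 \<and> x \<in> E} = C"
  proof -
    have "{r *\<^sub>R x |r x. 0 < r \<and> r < 1 \<and> x \<in> E} = sgn -` E \<inter> (ball 0 1 - {0})"
      using cone_eq[OF sub] by simp
    also have "\<dots> = C"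
      by (auto simp: E_def C_def sgn_div_norm norm_sgn)
    finally show ?thesis .
  qed
  define s where "s u v = sqrt (1 + u\<^sup>2 + v\<^sup>2)" for u v :: real
  have s_pos: "s u v > 0" for u v
    by (simp add: s_def add_pos_nonneg)
  have s_m[measurable]: "(\<lambda>w. s (f w) (g w)) \<in> borel_measurable M"
    if "f \<in> borel_measurable M" "g \<in> borel_measurable M" for f g and M :: "'z measure"
    unfolding s_def using that by measurable
  define F where "F x y z = (indicator C (from_coords i j (x, y, z)) :: ennreal)" for x y z
  have F_m[measurable]: "(\<lambda>w. F (f w) (g w) (h w)) \<in> borel_measurable M"
    if "f \<in> borel_measurable M" "g \<in> borel_measurable M" "h \<in> borel_measurable M"
    for f g h and M :: "'z measure"
  proof -
    note that[measurable]
    have "(\<lambda>w. from_coords i j (f w, g w, h w)) \<in> borel_measurable M"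
      by measurable
    then show ?thesis unfolding F_def by measurable
  qed
  have F0: "F 0 y z = 0" for y z
    by (simp add: F_def C_def from_coords_def)
  have F_scale: "F x (x * u) (x * v) = indicator {x. \<bar>x\<bar> * s u v < 1} x * indicator A (u, v)"
    if "x \<noteq> 0" for x u v
  proof -
    let ?p = "from_coords i j (x, x * u, x * v)"
    have p: "?p $ i = x" "?p $ j = x * u" "?p $ k = x * v"
      using ijk by (auto simp: from_coords_def)
    have "(norm ?p)\<^sup>2 = x\<^sup>2 + ((x * u)\<^sup>2 + (x * v)\<^sup>2)"
      unfolding power2_norm_eq_inner inner_vec_def UN using ijk p by (simp add: power2_eq_square)
    also have "\<dots> = (\<bar>x\<bar> * s u v)\<^sup>2"
      by (simp add: s_def power_mult_distrib algebra_simps)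
    finally have "norm ?p = \<bar>x\<bar> * s u v"
      using s_pos[of u v] by (simp add: power2_eq_iff_nonneg)
    then show ?thesis
      using that by (simp add: F_def C_def p indicator_def)
  qed
  define g where "g x w = ennreal (x\<^sup>2) *
    (indicator {x. \<bar>x\<bar> * s (fst w) (snd w) < 1} x * indicator A w)" for x :: real and w
  have g_m[measurable]: "case_prod g \<in> borel_measurable (borel \<Otimes>\<^sub>M borel)"
  proof -
    have [measurable]: "A \<in> sets (borel \<Otimes>\<^sub>M borel)"
      unfolding borel_prod by (rule A)
    have "case_prod g \<in> borel_measurable (borel \<Otimes>\<^sub>M (borel \<Otimes>\<^sub>M borel))"
      unfolding g_def case_prod_beta by measurable
    then show ?thesis by (simp add: borel_prod)
  qed
  have "emeasure lborel C = emeasure (distr lborel borel (from_coords i j)) C"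
    by (simp add: lborel_from_coords[OF ijk UN])
  also have "\<dots> = (\<integral>\<^sup>+w. F (fst w) (fst (snd w)) (snd (snd w)) \<partial>lborel)"
  proof -
    have "emeasure (distr lborel borel (from_coords i j)) C
        = (\<integral>\<^sup>+p. indicator C p \<partial>distr lborel borel (from_coords i j))"
      by simp
    also have "\<dots> = (\<integral>\<^sup>+w. indicator C (from_coords i j w) \<partial>lborel)"
      by (rule nn_integral_distr) auto
    finally show ?thesis by (simp add: F_def)
  qed
  also have "\<dots> = (\<integral>\<^sup>+x. \<integral>\<^sup>+y. \<integral>\<^sup>+z. F x y z \<partial>lborel \<partial>lborel \<partial>lborel)"
  proof -
    have Fb: "(\<lambda>w. F (fst w) (fst (snd w)) (snd (snd w))) \<in> borel_measurable borel"
      unfolding F_def by simp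
    have "(\<integral>\<^sup>+w. F (fst w) (fst (snd w)) (snd (snd w)) \<partial>lborel)
        = (\<integral>\<^sup>+w. F (fst w) (fst (snd w)) (snd (snd w)) \<partial>(lborel \<Otimes>\<^sub>M lborel))"
      by (simp only: lborel_prod)
    also have "\<dots> = (\<integral>\<^sup>+x. \<integral>\<^sup>+w. F x (fst w) (snd w) \<partial>lborel \<partial>lborel)"
      by (subst lborel.nn_integral_fst[symmetric]) (simp_all add: lborel_prod Fb)
    also have "\<dots> = (\<integral>\<^sup>+x. \<integral>\<^sup>+y. \<integral>\<^sup>+z. F x y z \<partial>lborel \<partial>lborel \<partial>lborel)"
    proof (rule nn_integral_cong)
      fix x
      have "(\<integral>\<^sup>+w. F x (fst w) (snd w) \<partial>(lborel \<Otimes>\<^sub>M lborel)) = (\<integral>\<^sup>+y. \<integral>\<^sup>+z. F x y z \<partial>lborel \<partial>lborel)"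
        by (subst lborel.nn_integral_fst[symmetric]) auto
      then show "(\<integral>\<^sup>+w. F x (fst w) (snd w) \<partial>lborel) = (\<integral>\<^sup>+y. \<integral>\<^sup>+z. F x y z \<partial>lborel \<partial>lborel)"
        by (simp only: lborel_prod)
    qed
    finally show ?thesis .
  qed
  also have "\<dots> = (\<integral>\<^sup>+x. \<integral>\<^sup>+u. \<integral>\<^sup>+v. g x (u, v) \<partial>lborel \<partial>lborel \<partial>lborel)"
  proof (rule nn_integral_cong)
    fix x :: real
    show "(\<integral>\<^sup>+y. \<integral>\<^sup>+z. F x y z \<partial>lborel \<partial>lborel) = (\<integral>\<^sup>+u. \<integral>\<^sup>+v. g x (u, v) \<partial>lborel \<partial>lborel)"
    proof (cases "x = 0")
      case True
      then show ?thesis by (simp add: F0 g_def)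
    next
      case False
      have "(\<integral>\<^sup>+y. \<integral>\<^sup>+z. F x y z \<partial>lborel \<partial>lborel)
          = (\<integral>\<^sup>+y. ennreal \<bar>x\<bar> * (\<integral>\<^sup>+v. F x y (x * v) \<partial>lborel) \<partial>lborel)"
        by (subst nn_integral_real_affine[where c = x and t = 0]) (use False in auto)
      also have "\<dots> = ennreal \<bar>x\<bar> * (\<integral>\<^sup>+u. ennreal \<bar>x\<bar> * (\<integral>\<^sup>+v. F x (x * u) (x * v) \<partial>lborel) \<partial>lborel)"
        by (subst nn_integral_real_affine[where c = x and t = 0]) (use False in auto)
      also have "\<dots> = (\<integral>\<^sup>+u. \<integral>\<^sup>+v. ennreal \<bar>x\<bar> * (ennreal \<bar>x\<bar> * F x (x * u) (x * v)) \<partial>lborel \<partial>lborel)"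
        by (simp add: nn_integral_cmult)
      also have "\<dots> = (\<integral>\<^sup>+u. \<integral>\<^sup>+v. g x (u, v) \<partial>lborel \<partial>lborel)"
        using False
        by (simp add: F_scale g_def power2_eq_square ennreal_mult'[symmetric] flip: mult.assoc)
      finally show ?thesis .
    qed
  qed
  also have "\<dots> = (\<integral>\<^sup>+x. \<integral>\<^sup>+w. g x w \<partial>(lborel \<Otimes>\<^sub>M lborel) \<partial>lborel)"
  proof -
    have "g x \<in> borel_measurable borel" for x
      using measurable_Pair2[OF g_m, of x] by simp
    then show ?thesis
      by (subst lborel.nn_integral_fst[symmetric]) (simp_all add: lborel_prod)
  qed
  also have "\<dots> = (\<integral>\<^sup>+w. \<integral>\<^sup>+x. g x w \<partial>lborel \<partial>(lborel \<Otimes>\<^sub>M lborel))"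
    unfolding lborel_prod by (rule lborel_pair.Fubini') auto
  also have "\<dots> = (\<integral>\<^sup>+v. \<integral>\<^sup>+u. \<integral>\<^sup>+x. g x (u, v) \<partial>lborel \<partial>lborel \<partial>lborel)"
  proof -
    have "(\<lambda>w. \<integral>\<^sup>+x. g x w \<partial>lborel) \<in> borel_measurable borel"
      by (intro lborel.borel_measurable_nn_integral)
         (use measurable_pair_swap[OF g_m] in \<open>simp add: case_prod_beta\<close>)
    then show ?thesis
      by (subst lborel_pair.nn_integral_snd[symmetric]) (simp_all add: lborel_prod)
  qed
  also have "\<dots> = (\<integral>\<^sup>+v. \<integral>\<^sup>+u. ennreal (2 / (3 * s u v ^ 3)) * indicator A (u, v) \<partial>lborel \<partial>lborel)"
  proof (intro nn_integral_cong)
    fix u v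
    have "(\<integral>\<^sup>+x. g x (u, v) \<partial>lborel)
      = (\<integral>\<^sup>+x. ennreal (x\<^sup>2) * indicator {x. \<bar>x\<bar> * s u v < 1} x * indicator A (u, v) \<partial>lborel)"
      by (simp add: g_def mult.assoc)
    also have "\<dots> = ennreal (2 / (3 * s u v ^ 3)) * indicator A (u, v)"
      by (subst nn_integral_multc) (simp_all add: nn_integral_square_symmetric_interval s_pos)
    finally show "(\<integral>\<^sup>+x. g x (u, v) \<partial>lborel) = ennreal (2 / (3 * s u v ^ 3)) * indicator A (u, v)" .
  qed
  finally have vol: "emeasure lborel C
    = (\<integral>\<^sup>+v. \<integral>\<^sup>+u. ennreal (2 / (3 * s u v ^ 3)) * indicator A (u, v) \<partial>lborel \<partial>lborel)" .
  have three: "3 * (ennreal (2 / (3 * s u v ^ 3)) * c) = ennreal (2 / s u v ^ 3) * c" for u v c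
  proof -
    have "3 * ennreal (2 / (3 * s u v ^ 3)) = ennreal (3 * (2 / (3 * s u v ^ 3)))"
      using s_pos[of u v] by (subst ennreal_mult) auto
    then show ?thesis by (simp flip: mult.assoc)
  qed
  have "emeasure sphere_area E = 3 * emeasure lborel C"
    using emeasure_sphere_area[OF E sub] by (simp only: cone)
  also have "\<dots> = (\<integral>\<^sup>+v. \<integral>\<^sup>+u. ennreal (2 / s u v ^ 3) * indicator A (u, v) \<partial>lborel \<partial>lborel)"
    unfolding vol by (simp add: three flip: nn_integral_cmult)
  finally show "emeasure sphere_area E
      = (\<integral>\<^sup>+v. \<integral>\<^sup>+u. ennreal (2 / sqrt (1 + u\<^sup>2 + v\<^sup>2) ^ 3) * indicator A (u, v) \<partial>lborel \<partial>lborel)"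
    by (simp add: s_def)
qed

section \<open>The region of one obtuse angle\<close>

text \<open>For \<open>\<bar>v\<bar> > 1\<close> the right-hand side is zero, as \<^const>\<open>ennreal\<close> sends negative reals to zero,
  in agreement with the empty slice.\<close>

lemma nn_integral_obtuse_slice:
  fixes v :: real
  shows "(\<integral>\<^sup>+u. ennreal (2 / sqrt (1 + u\<^sup>2 + v\<^sup>2) ^ 3)
            * indicator {(u, v). \<bar>v\<bar> * sqrt (1 + u\<^sup>2 + v\<^sup>2) < \<bar>u\<bar>} (u, v) \<partial>lborel)
      = ennreal (4 * (1 - \<bar>v\<bar>) / (1 + v\<^sup>2))"
proof (cases "\<bar>v\<bar> < 1")
  case False
  have "\<not> \<bar>v\<bar> * sqrt (1 + u\<^sup>2 + v\<^sup>2) < \<bar>u\<bar>" for u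
  proof -
    have "\<bar>u\<bar> \<le> sqrt (1 + u\<^sup>2 + v\<^sup>2)"
      by (rule real_le_rsqrt) simp
    also have "\<dots> \<le> \<bar>v\<bar> * sqrt (1 + u\<^sup>2 + v\<^sup>2)"
      using False mult_right_mono[of 1 "\<bar>v\<bar>" "sqrt (1 + u\<^sup>2 + v\<^sup>2)"] by simp
    finally show ?thesis by simp
  qed
  moreover have "4 * (1 - \<bar>v\<bar>) / (1 + v\<^sup>2) \<le> 0"
    using False by (intro divide_nonpos_nonneg) auto
  ultimately show ?thesis by (simp add: ennreal_neg)
next
  case True
  \<comment> \<open>the non-negative solution \<open>u\<close> of \<open>\<bar>v\<bar> * sqrt (1 + u\<^sup>2 + v\<^sup>2) = u\<close>\<close>
  define U where "U = \<bar>v\<bar> * sqrt ((1 + v\<^sup>2) / (1 - v\<^sup>2))"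
  have v1: "v\<^sup>2 < 1"
    using True by (simp add: abs_square_less_1)
  have v2: "1 + v\<^sup>2 > 0" by (simp add: add_pos_nonneg)
  have U0: "U \<ge> 0" using v1 by (simp add: U_def)
  have U2: "U\<^sup>2 = v\<^sup>2 * (1 + v\<^sup>2) / (1 - v\<^sup>2)"
    using v1 v2 by (simp add: U_def power_mult_distrib)
  have pos: "1 + u\<^sup>2 + v\<^sup>2 > 0" for u :: real
    by (simp add: add_pos_nonneg)
  have region: "\<bar>v\<bar> * sqrt (1 + u\<^sup>2 + v\<^sup>2) < u \<longleftrightarrow> U < u" if "u \<ge> 0" for u
  proof -
    have "\<bar>v\<bar> * sqrt (1 + u\<^sup>2 + v\<^sup>2) < u \<longleftrightarrow> (\<bar>v\<bar> * sqrt (1 + u\<^sup>2 + v\<^sup>2))\<^sup>2 < u\<^sup>2"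
      using that pos[of u] using abs_le_square_iff[of u "\<bar>v\<bar> * sqrt (1 + u\<^sup>2 + v\<^sup>2)"] pos[of u]
      by (simp add: not_le[symmetric] abs_mult)
    also have "\<dots> \<longleftrightarrow> U\<^sup>2 < u\<^sup>2"
      using v1 v2 pos[of u] by (simp add: U2 power_mult_distrib field_simps)
    also have "\<dots> \<longleftrightarrow> U < u"
      using that U0 by (meson power2_less_imp_less power_strict_mono zero_less_numeral)
    finally show ?thesis .
  qed
  have "(\<integral>\<^sup>+u. ennreal (2 / sqrt (1 + u\<^sup>2 + v\<^sup>2) ^ 3)
            * indicator {(u, v). \<bar>v\<bar> * sqrt (1 + u\<^sup>2 + v\<^sup>2) < \<bar>u\<bar>} (u, v) \<partial>lborel)
     = 2 * (\<integral>\<^sup>+u. ennreal (2 / sqrt (1 + u\<^sup>2 + v\<^sup>2) ^ 3)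
            * indicator {(u, v). \<bar>v\<bar> * sqrt (1 + u\<^sup>2 + v\<^sup>2) < \<bar>u\<bar>} (u, v) * indicator {0..} u \<partial>lborel)"
    by (rule nn_integral_lborel_even) (auto simp: indicator_def)
  also have "(\<integral>\<^sup>+u. ennreal (2 / sqrt (1 + u\<^sup>2 + v\<^sup>2) ^ 3)
            * indicator {(u, v). \<bar>v\<bar> * sqrt (1 + u\<^sup>2 + v\<^sup>2) < \<bar>u\<bar>} (u, v) * indicator {0..} u \<partial>lborel)
     = (\<integral>\<^sup>+u. ennreal (2 / sqrt (1 + u\<^sup>2 + v\<^sup>2) ^ 3) * indicator {U..} u \<partial>lborel)"
    using U0 by (intro nn_integral_cong_AE eventually_mono[OF AE_lborel_singleton[of U]])
       (auto simp: indicator_def region)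
  also have "\<dots> = ennreal (2 / (1 + v\<^sup>2) - 2 / (1 + v\<^sup>2) * (U / sqrt (1 + U\<^sup>2 + v\<^sup>2)))"
  proof (rule nn_integral_FTC_atLeast)
    fix u :: real
    let ?s = "sqrt (1 + u\<^sup>2 + v\<^sup>2)"
    have s: "?s > 0" "?s\<^sup>2 = 1 + u\<^sup>2 + v\<^sup>2" using pos[of u] by auto
    have "((\<lambda>u. u / sqrt (1 + u\<^sup>2 + v\<^sup>2)) has_real_derivative
       (?s - u * (u / ?s)) / ?s\<^sup>2) (at u)"
      using pos[of u] s(1)
      by (auto intro!: derivative_eq_intros simp: field_simps power2_eq_square)
    also have "?s - u * (u / ?s) = (1 + v\<^sup>2) / ?s"
      using s by (simp add: field_simps flip: power2_eq_square)
    finally have "((\<lambda>u. u / sqrt (1 + u\<^sup>2 + v\<^sup>2)) has_real_derivative (1 + v\<^sup>2) / ?s ^ 3) (at u)"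
      by (simp add: power2_eq_square power3_eq_cube mult_ac)
    moreover have "2 / (1 + v\<^sup>2) * ((1 + v\<^sup>2) / ?s ^ 3) = 2 / ?s ^ 3"
      using v2 by (metis less_irrefl nonzero_mult_divide_mult_cancel_right times_divide_times_eq mult.commute)
    ultimately
    show "((\<lambda>u. 2 / (1 + v\<^sup>2) * (u / sqrt (1 + u\<^sup>2 + v\<^sup>2))) has_real_derivative 2 / ?s ^ 3) (at u)"
      using DERIV_cmult[of "\<lambda>u. u / sqrt (1 + u\<^sup>2 + v\<^sup>2)" "(1 + v\<^sup>2) / ?s ^ 3" u UNIV "2 / (1 + v\<^sup>2)"]
      by (simp only:)
    show "0 \<le> 2 / ?s ^ 3" using s by simp
  next
    have "((\<lambda>u. u / sqrt (1 + u\<^sup>2 + v\<^sup>2)) \<longlongrightarrow> 1) at_top"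
      by real_asymp
    from tendsto_mult_left[OF this, of "2 / (1 + v\<^sup>2)"]
    show "((\<lambda>u. 2 / (1 + v\<^sup>2) * (u / sqrt (1 + u\<^sup>2 + v\<^sup>2))) \<longlongrightarrow> 2 / (1 + v\<^sup>2)) at_top"
      by simp
  qed simp
  also have "U / sqrt (1 + U\<^sup>2 + v\<^sup>2) = \<bar>v\<bar>"
  proof -
    have "1 + U\<^sup>2 + v\<^sup>2 = (1 + v\<^sup>2) / (1 - v\<^sup>2)"
      using v1 by (simp add: U2 field_simps)
    then show ?thesis using v1 v2 by (simp add: U_def)
  qed
  also have "2 / (1 + v\<^sup>2) - 2 / (1 + v\<^sup>2) * \<bar>v\<bar> = 2 * (1 - \<bar>v\<bar>) / (1 + v\<^sup>2)"
    by (simp add: diff_divide_distrib right_diff_distrib)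
  also have "2 * ennreal (2 * (1 - \<bar>v\<bar>) / (1 + v\<^sup>2)) = ennreal (2 * (2 * (1 - \<bar>v\<bar>) / (1 + v\<^sup>2)))"
    using True by (subst ennreal_mult) auto
  also have "2 * (2 * (1 - \<bar>v\<bar>) / (1 + v\<^sup>2)) = 4 * (1 - \<bar>v\<bar>) / (1 + v\<^sup>2)"
    by simp
  finally show ?thesis .
qed

lemma nn_integral_obtuse_slices:
  "(\<integral>\<^sup>+v. ennreal (4 * (1 - \<bar>v\<bar>) / (1 + v\<^sup>2)) \<partial>lborel) = ennreal (2 * pi - 4 * ln 2)"
proof -
  have pos: "1 + v\<^sup>2 > 0" for v :: real by (simp add: add_pos_nonneg)
  have "(\<integral>\<^sup>+v. ennreal (4 * (1 - \<bar>v\<bar>) / (1 + v\<^sup>2)) \<partial>lborel)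
      = 2 * (\<integral>\<^sup>+v. ennreal (4 * (1 - \<bar>v\<bar>) / (1 + v\<^sup>2)) * indicator {0..} v \<partial>lborel)"
    by (rule nn_integral_lborel_even) auto
  also have "(\<integral>\<^sup>+v. ennreal (4 * (1 - \<bar>v\<bar>) / (1 + v\<^sup>2)) * indicator {0..} v \<partial>lborel)
     = (\<integral>\<^sup>+v. ennreal (4 * (1 - v) / (1 + v\<^sup>2)) * indicator {0..1} v \<partial>lborel)"
    \<comment> \<open>beyond 1 the integrand is the \<^const>\<open>ennreal\<close> of a negative number\<close>
    by (intro nn_integral_cong)
       (auto simp: indicator_def intro!: ennreal_neg divide_nonpos_pos pos)
  also have "\<dots> = ennreal ((4 * arctan 1 - 2 * ln (1 + 1\<^sup>2)) - (4 * arctan 0 - 2 * ln (1 + 0\<^sup>2)))"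
  proof (rule nn_integral_FTC_Icc)
    fix v :: real assume "v \<in> {0..1}"
    then show "0 \<le> 4 * (1 - v) / (1 + v\<^sup>2)" by simp
    show "((\<lambda>v. 4 * arctan v - 2 * ln (1 + v\<^sup>2)) has_real_derivative 4 * (1 - v) / (1 + v\<^sup>2))
(at v)"
    proof -
      have "((\<lambda>v. 4 * arctan v - 2 * ln (1 + v\<^sup>2)) has_real_derivative
          4 * inverse (1 + v\<^sup>2) - 2 * (2 * v / (1 + v\<^sup>2))) (at v)"
        using pos[of v] by (auto intro!: derivative_eq_intros)
      also have "4 * inverse (1 + v\<^sup>2) - 2 * (2 * v / (1 + v\<^sup>2)) = 4 * (1 - v) / (1 + v\<^sup>2)"
        by (simp add: divide_inverse algebra_simps)
      finally show ?thesis .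
    qed
  qed auto
  also have "(4 * arctan 1 - 2 * ln (1 + 1\<^sup>2)) - (4 * arctan 0 - 2 * ln (1 + 0\<^sup>2)) = pi - 2 * ln (2::real)"
    by (simp add: arctan_one)
  also have "2 * ennreal (pi - 2 * ln 2) = ennreal (2 * (pi - 2 * ln 2))"
  proof -
    have "ln (2::real) \<le> 1" using ln_le_minus_one[of 2] by simp
    then have "pi - 2 * ln 2 \<ge> 0" using pi_gt3 by simp
    then show ?thesis by (subst ennreal_mult) auto
  qed
  also have "2 * (pi - 2 * ln 2) = 2 * pi - 4 * ln (2::real)" by simp
  finally show ?thesis .
qed

lemma obtuse_at_iff:
  fixes x y z :: real
  assumes "x\<^sup>2 + y\<^sup>2 + z\<^sup>2 = 1"
  shows "(1 - x\<^sup>2)\<^sup>2 + (1 - y\<^sup>2)\<^sup>2 < (1 - z\<^sup>2)\<^sup>2 \<longleftrightarrow> \<bar>z\<bar> < \<bar>x * y\<bar>"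
proof -
  have z: "z\<^sup>2 = 1 - x\<^sup>2 - y\<^sup>2" using assms by simp
  have "(1 - z\<^sup>2)\<^sup>2 - ((1 - x\<^sup>2)\<^sup>2 + (1 - y\<^sup>2)\<^sup>2) = 2 * (x\<^sup>2 * y\<^sup>2 - z\<^sup>2)"
    unfolding z by (simp add: power2_eq_square algebra_simps)
  then have "(1 - x\<^sup>2)\<^sup>2 + (1 - y\<^sup>2)\<^sup>2 < (1 - z\<^sup>2)\<^sup>2 \<longleftrightarrow> z\<^sup>2 < (x * y)\<^sup>2"
    by (simp add: power_mult_distrib) linarith
  then show ?thesis by (simp add: abs_le_square_iff flip: not_le)
qed

text \<open>For \<open>x \<noteq> 0\<close> on the sphere, \<open>sqrt (1 + u\<^sup>2 + v\<^sup>2) = 1 / \<bar>x\<bar>\<close>, so dividing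
  \<open>\<bar>z\<bar> < \<bar>x y\<bar>\<close> by \<open>x\<^sup>2\<close> gives the region of the previous integrals; points with
  \<open>x = 0\<close>, invisible in the chart, do not satisfy the inequality.\<close>

lemma area_obtuse_at:
  fixes i j k :: 3
  assumes ijk: "distinct [i, j, k]"
  defines "E \<equiv> {p \<in> sphere (0 :: real ^ 3) 1. \<bar>p $ k\<bar> < \<bar>p $ i * p $ j\<bar>}"
  shows "E \<in> sets borel" and "emeasure sphere_area E = ennreal (2 * pi - 4 * ln 2)"
proof -
  define A :: "(real \<times> real) set" where "A = {(u, v). \<bar>v\<bar> * sqrt (1 + u\<^sup>2 + v\<^sup>2) < \<bar>u\<bar>}"
  have A: "A \<in> sets borel"
    unfolding A_def case_prod_beta
    by (intro borel_open open_Collect_less continuous_intros)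
  note UN = UNIV_3_eq[OF ijk]
  have E_eq: "E = {p \<in> sphere 0 1. p $ i \<noteq> 0 \<and> (p $ j / p $ i, p $ k / p $ i) \<in> A}"
  proof -
    have "\<bar>p $ k\<bar> < \<bar>p $ i * p $ j\<bar> \<longleftrightarrow> p $ i \<noteq> 0 \<and> (p $ j / p $ i, p $ k / p $ i) \<in> A"
      if "norm p = 1" for p :: "real ^ 3"
    proof (cases "p $ i = 0")
      case False
      have "(p $ i)\<^sup>2 + ((p $ j)\<^sup>2 + (p $ k)\<^sup>2) = 1"
        using that ijk unfolding norm_eq_1 inner_vec_def UN by (simp add: power2_eq_square)
      then have "1 + (p $ j / p $ i)\<^sup>2 + (p $ k / p $ i)\<^sup>2 = (1 / p $ i)\<^sup>2"
        using False by (simp add: power_divide field_simps)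
      then have "sqrt (1 + (p $ j / p $ i)\<^sup>2 + (p $ k / p $ i)\<^sup>2) = 1 / \<bar>p $ i\<bar>"
        by (simp add: real_sqrt_abs)
      then show ?thesis
        using False by (simp add: A_def abs_mult field_simps)
    qed simp
    then show ?thesis unfolding E_def by auto
  qed
  show "E \<in> sets borel"
    unfolding E_eq by (rule sphere_area_gnomonic(1)[OF ijk A])
  show "emeasure sphere_area E = ennreal (2 * pi - 4 * ln 2)"
    unfolding E_eq sphere_area_gnomonic(2)[OF ijk A]
    unfolding A_def nn_integral_obtuse_slice nn_integral_obtuse_slices ..
qed

section \<open>The obtuse triangles\<close>

lemma sphere_area_obtuse:
  defines "S \<equiv> {p \<in> sphere 0 1. obtuse (triangle_of p)}"
  shows "S \<in> sets borel" and "emeasure sphere_area S = ennreal (6 * pi - 12 * ln 2)"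
proof -
  define E where "E i j k = {p \<in> sphere (0 :: real ^ 3) 1. \<bar>p $ k\<bar> < \<bar>p $ i * p $ j\<bar>}" for i j k
  have sum1: "(p $ 1)\<^sup>2 + (p $ 2)\<^sup>2 + (p $ 3)\<^sup>2 = 1" if "p \<in> sphere 0 1" for p :: "real ^ 3"
    using that by (simp add: norm_eq_1 inner_vec_def sum_3 power2_eq_square)
  have E_iff:
    "p \<in> E 1 2 3 \<longleftrightarrow> (1 - (p $ 1)\<^sup>2)\<^sup>2 + (1 - (p $ 2)\<^sup>2)\<^sup>2 < (1 - (p $ 3)\<^sup>2)\<^sup>2"
    "p \<in> E 2 3 1 \<longleftrightarrow> (1 - (p $ 2)\<^sup>2)\<^sup>2 + (1 - (p $ 3)\<^sup>2)\<^sup>2 < (1 - (p $ 1)\<^sup>2)\<^sup>2"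
    "p \<in> E 3 1 2 \<longleftrightarrow> (1 - (p $ 3)\<^sup>2)\<^sup>2 + (1 - (p $ 1)\<^sup>2)\<^sup>2 < (1 - (p $ 2)\<^sup>2)\<^sup>2"
    if "p \<in> sphere 0 1" for p
    using that sum1[OF that]
    by (simp_all add: E_def obtuse_at_iff[of "p $ 1" "p $ 2" "p $ 3"]
        obtuse_at_iff[of "p $ 2" "p $ 3" "p $ 1"] obtuse_at_iff[of "p $ 3" "p $ 1" "p $ 2"])
  have sub: "E i j k \<subseteq> sphere 0 1" for i j k by (auto simp: E_def)
  have S_eq: "S = E 1 2 3 \<union> E 2 3 1 \<union> E 3 1 2"
  proof (intro set_eqI)
    show "p \<in> S \<longleftrightarrow> p \<in> E 1 2 3 \<union> E 2 3 1 \<union> E 3 1 2" for p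
    proof (cases "p \<in> sphere 0 1")
      case True
      then show ?thesis
        using E_iff[OF True] by (simp add: S_def obtuse_def triangle_of_def)
    next
      case False
      then show ?thesis
        using sub by (auto simp: S_def E_def)
    qed
  qed
  have disj: "E 1 2 3 \<inter> E 2 3 1 = {}" "(E 1 2 3 \<union> E 2 3 1) \<inter> E 3 1 2 = {}"
  proof -
    have "p \<notin> E 2 3 1 \<and> p \<notin> E 3 1 2" if "p \<in> E 1 2 3" for p
    proof -
      have "p \<in> sphere 0 1" using sub that by blast
      from that show ?thesis
        unfolding E_iff[OF \<open>p \<in> sphere 0 1\<close>] by (smt (verit) zero_le_power2)
    qed
    moreover have "p \<notin> E 3 1 2" if "p \<in> E 2 3 1" for p
    proof -
      have "p \<in> sphere 0 1" using sub that by blast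
      from that show ?thesis
        unfolding E_iff[OF \<open>p \<in> sphere 0 1\<close>] by (smt (verit) zero_le_power2)
    qed
    ultimately show "E 1 2 3 \<inter> E 2 3 1 = {}" "(E 1 2 3 \<union> E 2 3 1) \<inter> E 3 1 2 = {}" by auto
  qed
  have area: "E 1 2 3 \<in> sets borel" "E 2 3 1 \<in> sets borel" "E 3 1 2 \<in> sets borel"
    "emeasure sphere_area (E 1 2 3) = ennreal (2 * pi - 4 * ln 2)"
    "emeasure sphere_area (E 2 3 1) = ennreal (2 * pi - 4 * ln 2)"
    "emeasure sphere_area (E 3 1 2) = ennreal (2 * pi - 4 * ln 2)"
    unfolding E_def by (rule area_obtuse_at; simp)+
  have sets: "E 1 2 3 \<in> sets sphere_area" "E 2 3 1 \<in> sets sphere_area" "E 3 1 2 \<in> sets sphere_area"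
    using area(1-3) sub by (auto simp: sets_restrict_space_iff)
  show "S \<in> sets borel"
    unfolding S_eq using area by auto
  have "emeasure sphere_area S = ennreal (2 * pi - 4 * ln 2) + ennreal (2 * pi - 4 * ln 2)
      + ennreal (2 * pi - 4 * ln 2)"
    unfolding S_eq using sets disj
    by (simp add: area plus_emeasure[symmetric])
  also have "\<dots> = ennreal (6 * pi - 12 * ln 2)"
  proof -
    have "ln (2::real) \<le> 1" using ln_le_minus_one[of 2] by simp
    then have "2 * pi - 4 * ln 2 \<ge> 0" using pi_gt3 by simp
    then show ?thesis by (simp flip: ennreal_plus)
  qed
  finally show "emeasure sphere_area S = ennreal (6 * pi - 12 * ln 2)" .
qed

theorem mainTheorem1:
  shows "measure symmetric_measure {t \<in> perimeter2_triangles. obtuse t} = 3 / 2 - 3 * ln 2 / pi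
    \<and> measure sphere_area {p \<in> sphere 0 1. obtuse (triangle_of p)} = 6 * pi - 12 * ln 2
    \<and> measure sphere_area (sphere 0 1) = 4 * pi"
proof (intro conjI)
  let ?S = "{p \<in> sphere 0 1. obtuse (triangle_of p)}"
  have nonneg: "6 * pi - 12 * ln 2 \<ge> 0"
    using ln_le_minus_one[of 2] pi_gt3 by simp
  show total: "measure sphere_area (sphere 0 1) = 4 * pi"
    by (simp add: measure_def sphere_area_total)
  show area: "measure sphere_area ?S = 6 * pi - 12 * ln 2"
    using nonneg unfolding measure_def sphere_area_obtuse(2) by (rule enn2real_ennreal)
  have T: "{t \<in> perimeter2_triangles. obtuse t} \<in> sets (restrict_space borel perimeter2_triangles)"
  proof -
    have "open {t. obtuse t}"
      unfolding obtuse_def case_prod_beta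
      by (intro open_Collect_disj open_Collect_less continuous_intros)
    then show ?thesis
      by (auto simp: sets_restrict_space image_iff intro!: bexI[of _ "{t. obtuse t}"])
  qed
  have m: "triangle_of \<in> sphere_uniform \<rightarrow>\<^sub>M restrict_space borel perimeter2_triangles"
    using triangle_of_measurable by (simp add: sphere_uniform_def cong: measurable_cong_sets)
  have sp: "space sphere_uniform = sphere 0 1"
    by (simp add: sphere_uniform_def)
  have "measure symmetric_measure {t \<in> perimeter2_triangles. obtuse t}
      = measure sphere_uniform (triangle_of -` {t \<in> perimeter2_triangles. obtuse t} \<inter> sphere 0 1)"
    unfolding symmetric_measure_def using measure_distr[OF m T] by (simp add: sp)
  also have "triangle_of -` {t \<in> perimeter2_triangles. obtuse t} \<inter> sphere 0 1 = ?S"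
    using measurable_space[OF m] by (auto simp: sp space_restrict_space)
  also have "measure sphere_uniform ?S = measure sphere_area ?S / measure sphere_area (sphere 0 1)"
  proof -
    have "sphere 0 1 \<inter> ?S = ?S" by auto
    moreover have "?S \<in> sets sphere_area"
      using sphere_area_obtuse(1) by (auto simp: sets_restrict_space_iff)
    ultimately show ?thesis
      unfolding sphere_uniform_def
      by (subst measure_uniform_measure) (auto simp: sphere_area_total)
  qed
  also have "\<dots> = 3 / 2 - 3 * ln 2 / pi"
    unfolding area total by (simp add: field_simps)
  finally show "measure symmetric_measure {t \<in> perimeter2_triangles. obtuse t} = 3 / 2 - 3 * ln 2 / pi" .
qed

end
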